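(* There is a universal constant $C>0$ such that the following holds. Let $n,m\ge 1$ be integers, let $\|\cdot\|$ be a norm on $\mathbb{R}^m$, and let $f:\{\pm 1\}^n\to\mathbb{R}^m$. Let $X$ be uniformly distributed in $\{\pm 1\}^n$. Then $$\mathbb{E}\left[\|f_{\mathrm{lin}}(X)\|^2\right]^{1/2}\le C\log(m+1)\cdot \mathbb{E}\left[\|f(X)\|^2\right]^{1/2},$$ where $f_{\mathrm{lin}}$ is the linear part of $f$.
   Context: For $S\subseteq[n]=\{1,\dots,n\}$, the character $\chi_S:\{\pm1\}^n\to\mathbb{R}$ is $\chi_S(x)=\prod_{j\in S}x_j$. Every $f:\{\pm1\}^n\to\mathbb{R}^m$ can be uniquely written as $f(x)=\sum_{S\subseteq[n]}\hat f(S)\chi_S(x)$, with Fourier coefficients $\hat f(S)\in\mathbb{R}^m$. The linear part of $f$ is $f_{\mathrm{lin}}(x)=\sum_{j=1}^n\hat f(\{j\})\,x_j$. *)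

theory Defs
  imports "HOL-Probability.Probability" "Jordan_Normal_Form.Matrix"
begin

(* otherwise $ is ambiguous with the indexing of the type-indexed vectors of HOL-Analysis *)
unbundle no vec_syntax

text \<open>
  Vectors of \<open>\<real>\<^sup>m\<close> are the elements of \<^term>\<open>carrier_vec m :: real vec set\<close>, so that the
  dimension is an ordinary variable and can be quantified after the constant.
\<close>

definition is_norm :: "nat \<Rightarrow> (real vec \<Rightarrow> real) \<Rightarrow> bool" where
  "is_norm m N \<longleftrightarrow>
     (\<forall>v\<in>carrier_vec m. 0 \<le> N v) \<and>
     (\<forall>v\<in>carrier_vec m. N v = 0 \<longleftrightarrow> v = 0\<^sub>v m) \<and>
     (\<forall>a. \<forall>v\<in>carrier_vec m. N (a \<cdot>\<^sub>v v) = \<bar>a\<bar> * N v) \<and>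
     (\<forall>v\<in>carrier_vec m. \<forall>w\<in>carrier_vec m. N (v + w) \<le> N v + N w)"

definition cube :: "nat \<Rightarrow> (nat \<Rightarrow> real) set" where
  "cube n = {1..n} \<rightarrow>\<^sub>E {-1, 1}"

definition cube_expectation :: "nat \<Rightarrow> ((nat \<Rightarrow> real) \<Rightarrow> real) \<Rightarrow> real" where
  "cube_expectation n g = measure_pmf.expectation (pmf_of_set (cube n)) g"

definition character :: "nat set \<Rightarrow> (nat \<Rightarrow> real) \<Rightarrow> real" where
  "character S x = (\<Prod>j\<in>S. x j)"

definition fourier_expansion ::
  "nat \<Rightarrow> nat \<Rightarrow> ((nat \<Rightarrow> real) \<Rightarrow> real vec) \<Rightarrow> (nat set \<Rightarrow> real vec) \<Rightarrow> bool" where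
  "fourier_expansion n m f c \<longleftrightarrow>
     c \<in> Pow {1..n} \<rightarrow>\<^sub>E carrier_vec m \<and>
     (\<forall>x\<in>cube n. f x = finsum_vec TYPE(real) m (\<lambda>S. character S x \<cdot>\<^sub>v c S) (Pow {1..n}))"

text \<open>
  The definite description in \<open>fourier_coeff\<close> is justified by \<open>ex1_fourier_expansion\<close> at the end of this theory.
\<close>

definition fourier_coeff ::
  "nat \<Rightarrow> nat \<Rightarrow> ((nat \<Rightarrow> real) \<Rightarrow> real vec) \<Rightarrow> nat set \<Rightarrow> real vec" where
  "fourier_coeff n m f = (THE c. fourier_expansion n m f c)"

definition linear_part ::
  "nat \<Rightarrow> nat \<Rightarrow> ((nat \<Rightarrow> real) \<Rightarrow> real vec) \<Rightarrow> (nat \<Rightarrow> real) \<Rightarrow> real vec" where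
  "linear_part n m f x =
     finsum_vec TYPE(real) m (\<lambda>j. x j \<cdot>\<^sub>v fourier_coeff n m f {j}) {1..n}"


subsection \<open>Existence and uniqueness of the Fourier expansion\<close>

lemma finite_cube: "finite (cube n)"
  unfolding cube_def by (intro finite_PiE) auto

lemma card_cube: "card (cube n) = 2 ^ n"
  unfolding cube_def by (simp add: card_PiE numeral_2_eq_2)

lemma cube_sq: "x \<in> cube n \<Longrightarrow> j \<in> {1..n} \<Longrightarrow> x j * x j = 1"
  unfolding cube_def PiE_def Pi_def by force

lemma sum_Pow_prod:
  fixes g h :: "nat \<Rightarrow> real"
  assumes "finite A"
  shows "(\<Sum>S\<in>Pow A. \<Prod>j\<in>S. h j) = (\<Prod>j\<in>A. 1 + h j)"
  using prod_add[OF assms, of h "\<lambda>_. 1"] by (simp add: add.commute)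

lemma sum_characters:
  assumes "x \<in> cube n" "y \<in> cube n"
  shows "(\<Sum>S\<in>Pow {1..n}. character S x * character S y) = (if x = y then 2 ^ n else 0)"
proof -
  have *: "(\<Sum>S\<in>Pow {1..n}. character S x * character S y) = (\<Prod>j\<in>{1..n}. 1 + x j * y j)"
    using sum_Pow_prod[of "{1..n}" "\<lambda>j. x j * y j"]
    by (simp add: character_def prod.distrib)
  show ?thesis
  proof (cases "x = y")
    case True
    have "(\<Prod>j\<in>{1..n}. 1 + x j * y j) = (\<Prod>j\<in>{1..n}. 2)"
      by (rule prod.cong) (use True cube_sq[OF assms(1)] in auto)
    then show ?thesis using * True by simp
  next
    case False
    then obtain j where j: "x j \<noteq> y j" by blast
    have jn: "j \<in> {1..n}"
    proof (rule ccontr)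
      assume "j \<notin> {1..n}"
      then show False using j assms unfolding cube_def by (metis PiE_arb)
    qed
    have "x j \<in> {-1,1}" "y j \<in> {-1,1}"
      using assms jn unfolding cube_def by (meson PiE_mem)+
    then have "1 + x j * y j = 0" using j by auto
    then have "(\<Prod>j\<in>{1..n}. 1 + x j * y j) = 0"
      using jn by (intro prod_zero) auto
    then show ?thesis using * False by simp
  qed
qed

lemma character_orthogonal:
  assumes "S \<subseteq> {1..n}" "T \<subseteq> {1..n}"
  shows "(\<Sum>x\<in>cube n. character S x * character T x) = (if S = T then 2 ^ n else 0)"
proof -
  define h where "h j t = (if j \<in> S then t else 1) * (if j \<in> T then t else 1)"
    for j :: nat and t :: real
  have ext: "character U x = (\<Prod>j\<in>{1..n}. if j \<in> U then x j else 1)"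
    if "U \<subseteq> {1..n}" for U x
    using that unfolding character_def
    by (subst prod.inter_restrict[symmetric]) (auto simp: Int_absorb1)
  have "(\<Sum>x\<in>cube n. character S x * character T x) = (\<Sum>x\<in>cube n. \<Prod>j\<in>{1..n}. h j (x j))"
    using assms by (simp add: ext h_def prod.distrib)
  also have "\<dots> = (\<Prod>j\<in>{1..n}. \<Sum>t\<in>{-1, 1}. h j t)"
    unfolding cube_def by (subst prod_sum_PiE) auto
  also have "\<dots> = (\<Prod>j\<in>{1..n}. if j \<in> S \<longleftrightarrow> j \<in> T then 2 else 0)"
    by (rule prod.cong) (auto simp: h_def)
  also have "\<dots> = (if S = T then 2 ^ n else 0)"
  proof (cases "S = T")
    case False
    then obtain j where "j \<in> {1..n}" "\<not> (j \<in> S \<longleftrightarrow> j \<in> T)" using assms by blast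
    then show ?thesis using False by (auto intro!: prod_zero)
  qed simp
  finally show ?thesis .
qed

lemma fourier_expansion_index:
  assumes f: "f \<in> cube n \<rightarrow> carrier_vec m"
  shows "fourier_expansion n m f c \<longleftrightarrow>
     c \<in> Pow {1..n} \<rightarrow>\<^sub>E carrier_vec m \<and>
     (\<forall>x\<in>cube n. \<forall>i<m. f x $ i = (\<Sum>S\<in>Pow {1..n}. character S x * c S $ i))"
proof (cases "c \<in> Pow {1..n} \<rightarrow>\<^sub>E carrier_vec m")
  case True
  have cS: "character S x \<cdot>\<^sub>v c S \<in> carrier_vec m" if "S \<in> Pow {1..n}" for S x
    using PiE_mem[OF True that] by simp
  have d: "finsum_vec TYPE(real) m (\<lambda>S. character S x \<cdot>\<^sub>v c S) (Pow {1..n}) \<in> carrier_vec m" for x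
    using cS by (intro finsum_vec_closed) auto
  have ix: "finsum_vec TYPE(real) m (\<lambda>S. character S x \<cdot>\<^sub>v c S) (Pow {1..n}) $ i =
      (\<Sum>S\<in>Pow {1..n}. character S x * c S $ i)" if i: "i < m" for x i
  proof -
    have "(character S x \<cdot>\<^sub>v c S) $ i = character S x * c S $ i" if "S \<in> Pow {1..n}" for S
      using PiE_mem[OF True that] i by auto
    then show ?thesis
      using cS i by (subst index_finsum_vec) (auto intro!: sum.cong)
  qed
  have "f x = finsum_vec TYPE(real) m (\<lambda>S. character S x \<cdot>\<^sub>v c S) (Pow {1..n}) \<longleftrightarrow>
     (\<forall>i<m. f x $ i = (\<Sum>S\<in>Pow {1..n}. character S x * c S $ i))" if x: "x \<in> cube n" for x
  proof -
    have "f x \<in> carrier_vec m" using f x by auto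
    then show ?thesis using d[of x] ix[of _ x]
      by (auto intro!: eq_vecI)
  qed
  then show ?thesis using True by (auto simp: fourier_expansion_def)
qed (simp add: fourier_expansion_def)

lemma fourier_expansion_iff:
  assumes f: "f \<in> cube n \<rightarrow> carrier_vec m"
  shows "fourier_expansion n m f c \<longleftrightarrow>
    c = (\<lambda>S\<in>Pow {1..n}. vec m (\<lambda>i. (\<Sum>x\<in>cube n. f x $ i * character S x) / 2 ^ n))"
    (is "_ \<longleftrightarrow> c = ?c")
proof
  assume "fourier_expansion n m f c"
  then have c: "c \<in> Pow {1..n} \<rightarrow>\<^sub>E carrier_vec m"
    and e: "\<And>x i. x \<in> cube n \<Longrightarrow> i < m \<Longrightarrow>
       f x $ i = (\<Sum>S\<in>Pow {1..n}. character S x * c S $ i)"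
    using fourier_expansion_index[OF f] by auto
  have "c T = vec m (\<lambda>i. (\<Sum>x\<in>cube n. f x $ i * character T x) / 2 ^ n)"
    if T: "T \<in> Pow {1..n}" for T
  proof (rule eq_vecI)
    have cT: "c T \<in> carrier_vec m" using c T by (rule PiE_mem)
    show "dim_vec (c T) = dim_vec (vec m (\<lambda>i. (\<Sum>x\<in>cube n. f x $ i * character T x) / 2 ^ n))"
      using cT by simp
    fix i assume "i < dim_vec (vec m (\<lambda>i. (\<Sum>x\<in>cube n. f x $ i * character T x) / 2 ^ n))"
    then have i: "i < m" by simp
    have "(\<Sum>x\<in>cube n. f x $ i * character T x) =
        (\<Sum>x\<in>cube n. \<Sum>S\<in>Pow {1..n}. c S $ i * (character S x * character T x))"
      by (rule sum.cong) (auto simp: e[OF _ i] sum_distrib_left sum_distrib_right mult_ac)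
    also have "\<dots> = (\<Sum>S\<in>Pow {1..n}. c S $ i * (\<Sum>x\<in>cube n. character S x * character T x))"
      by (subst sum.swap) (simp add: sum_distrib_left)
    also have "\<dots> = (\<Sum>S\<in>Pow {1..n}. if S = T then c S $ i * 2 ^ n else 0)"
      by (rule sum.cong) (use T character_orthogonal in auto)
    also have "\<dots> = c T $ i * 2 ^ n" using T by (subst sum.delta) auto
    finally show "c T $ i = vec m (\<lambda>i. (\<Sum>x\<in>cube n. f x $ i * character T x) / 2 ^ n) $ i"
      using i by simp
  qed
  note c_eq = this
  show "c = ?c"
  proof (rule ext)
    fix T show "c T = ?c T"
    proof (cases "T \<in> Pow {1..n}")
      case True
      then have "?c T = vec m (\<lambda>i. (\<Sum>x\<in>cube n. f x $ i * character T x) / 2 ^ n)"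
        by (rule restrict_apply')
      with c_eq[OF True] show ?thesis by (rule trans[OF _ sym])
    next
      case False
      then have "?c T = undefined" by (simp only: restrict_apply if_False)
      with PiE_arb[OF c False] show ?thesis by (rule trans[OF _ sym])
    qed
  qed
next
  assume c: "c = ?c"
  have cS: "c S $ i = (\<Sum>y\<in>cube n. f y $ i * character S y) / 2 ^ n"
    if "S \<in> Pow {1..n}" "i < m" for S i
    using that unfolding c by simp
  have "f x $ i = (\<Sum>S\<in>Pow {1..n}. character S x * c S $ i)" if x: "x \<in> cube n" and i: "i < m" for x i
  proof -
    have "(\<Sum>S\<in>Pow {1..n}. character S x * c S $ i) =
       (\<Sum>S\<in>Pow {1..n}. \<Sum>y\<in>cube n. f y $ i / 2 ^ n * (character S x * character S y))"
      by (rule sum.cong) (simp_all add: cS i sum_distrib_left sum_divide_distrib mult_ac)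
    also have "\<dots> = (\<Sum>y\<in>cube n. f y $ i / 2 ^ n * (\<Sum>S\<in>Pow {1..n}. character S x * character S y))"
      by (subst sum.swap) (simp add: sum_distrib_left)
    also have "\<dots> = (\<Sum>y\<in>cube n. if y = x then f y $ i else 0)"
      by (rule sum.cong) (simp_all add: sum_characters[OF x] del: One_nat_def)
    also have "\<dots> = f x $ i" using x finite_cube by (subst sum.delta) auto
    finally show ?thesis by simp
  qed
  moreover have "c \<in> Pow {1..n} \<rightarrow>\<^sub>E carrier_vec m" unfolding c by (auto simp: PiE_def)
  ultimately show "fourier_expansion n m f c"
    using fourier_expansion_index[OF f] by blast
qed

theorem ex1_fourier_expansion:
  assumes "f \<in> cube n \<rightarrow> carrier_vec m"
  shows "\<exists>!c. fourier_expansion n m f c"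
  unfolding fourier_expansion_iff[OF assms] by (rule ex1I) (rule refl, assumption)

lemma fourier_coeff_eq:
  assumes "f \<in> cube n \<rightarrow> carrier_vec m" "S \<subseteq> {1..n}"
  shows "fourier_coeff n m f S =
    vec m (\<lambda>i. (\<Sum>x\<in>cube n. f x $ i * character S x) / 2 ^ n)"
  using assms(2) by (simp add: fourier_coeff_def fourier_expansion_iff[OF assms(1)])

end

(*
Write T_rho for the noise operator, which multiplies the Fourier coefficient of S by rho^|S|. Its
kernel prod_j (1 + rho x_j y_j) is nonnegative with mean 1, so T_rho is a contraction of L^2 for every
norm whenever |rho| <= 1. As rho varies, T_rho f is a polynomial in rho with linear coefficient f_lin.
Substituting rho = sin(theta)/2 turns the extraction of that coefficient, up to degree d, into
differentiating a trigonometric polynomial at 0, which by M. Riesz's interpolation formula is a signed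
combination of point values with total weight O(d). Hence f_lin = sum_r w_r T_{rho_r} f + R f with
sum_r |w_r| <= 4d, where R only involves degrees above d and, since |rho_r| <= 1/2, is a Fourier multiplier of
size at most 4d/2^d. On scalar functions R is bounded by Parseval. Expanding the values of f in an
Auerbach-type basis costs a factor m, which is absorbed by 2^d >= m, that is, d of order log(m+1).
*)
theory Submission
  imports Defs "Jordan_Normal_Form.Determinant"
begin

section \<open>Extracting the linear coefficient of a polynomial\<close>

text \<open>A geometric sum over powers of a \<open>q\<close>-th root of unity. The bound on
  \<open>j\<close> keeps that root different from 1 unless \<open>j = 0\<close>, so no aliasing
  occurs.\<close>

lemma sum_cis_roots_of_unity:
  fixes j :: int and q :: nat
  assumes "\<bar>j\<bar> < int q"
  shows "(\<Sum>r<q. cis (of_int j * (2 * pi * real r / real q))) = (if j = 0 then of_nat q else 0)"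
proof (cases "j = 0")
  case False
  define z where "z = cis (of_int j * (2 * pi / real q))"
  have q: "q > 0" using assms by linarith
  have pw: "z ^ r = cis (of_int j * (2 * pi * real r / real q))" for r
    unfolding z_def Complex.DeMoivre by (rule arg_cong[of _ _ cis]) (simp add: field_simps)
  have "z \<noteq> 1"
  proof
    assume "z = 1"
    then have "cos (of_int j * (2 * pi / real q)) = 1"
      unfolding z_def by (metis cis.sel(1) one_complex.sel(1))
    then obtain k :: int where "of_int j * (2 * pi / real q) = of_int k * 2 * pi"
      using cos_one_2pi_int by auto
    then have "real_of_int j = of_int (k * int q)" using q by (simp add: field_simps)
    then have "j = k * int q" by linarith
    then show False using assms False dvd_imp_le_int[of j "int q"] by (simp add: zdvd_not_zless)
  qed
  moreover have "z ^ q = 1"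
    unfolding pw using q cis_multiple_2pi[of "of_int j"] by (simp add: mult_ac)
  ultimately show ?thesis
    using False geometric_sum[of z q] by (simp add: pw)
qed simp

text \<open>Expanding the squared modulus gives the frequencies \<open>a - b + s\<close>, all
  smaller than \<open>q\<close> in modulus. Orthogonality keeps the pairs with
  \<open>b = a + s\<close>, and there are \<open>d - nat \<bar>s\<bar>\<close> of them. The
  truncated subtraction covers \<open>d \<le> \<bar>s\<bar>\<close>, where no pair is left.\<close>

lemma sum_Fejer_cis:
  fixes s :: int and d q :: nat
  assumes "\<bar>s\<bar> + int d \<le> int q" and "d \<ge> 1"
  shows "(\<Sum>r<q. of_real ((cmod (\<Sum>a<d. cis (real a * (2 * pi * real r / real q))))\<^sup>2) *
            cis (of_int s * (2 * pi * real r / real q)))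
         = of_nat q * of_nat (d - nat \<bar>s\<bar>)"
proof -
  define \<theta> where "\<theta> r = 2 * pi * real r / real q" for r
  have sq: "of_real ((cmod (\<Sum>a<d. cis (real a * \<theta> r)))\<^sup>2) * cis (of_int s * \<theta> r)
      = (\<Sum>a<d. \<Sum>b<d. cis (of_int (int a - int b + s) * \<theta> r))" for r
  proof -
    have "of_real ((cmod (\<Sum>a<d. cis (real a * \<theta> r)))\<^sup>2)
        = (\<Sum>a<d. cis (real a * \<theta> r)) * (\<Sum>b<d. cis (- (real b * \<theta> r)))"
      by (subst complex_norm_square) (simp add: cis_cnj)
    also have "\<dots> * cis (of_int s * \<theta> r)
        = (\<Sum>a<d. \<Sum>b<d. cis (real a * \<theta> r) * cis (- (real b * \<theta> r)) * cis (of_int s * \<theta> r))"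
      unfolding sum_product by (simp only: sum_distrib_right)
    also have "\<dots> = (\<Sum>a<d. \<Sum>b<d. cis (of_int (int a - int b + s) * \<theta> r))"
      by (simp add: cis_mult algebra_simps)
    finally show ?thesis .
  qed
  have "(\<Sum>r<q. \<Sum>a<d. \<Sum>b<d. cis (of_int (int a - int b + s) * \<theta> r))
      = (\<Sum>a<d. \<Sum>b<d. \<Sum>r<q. cis (of_int (int a - int b + s) * \<theta> r))"
    by (subst sum.swap, rule sum.cong[OF refl], rule sum.swap)
  also have "\<dots> = (\<Sum>a<d. \<Sum>b<d. if int a - int b + s = 0 then of_nat q else 0)"
    unfolding \<theta>_def using assms by (intro sum.cong[OF refl] sum_cis_roots_of_unity) auto
  also have "\<dots> = (\<Sum>a<d. if 0 \<le> int a + s \<and> int a + s < int d then of_nat q else 0)"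
  proof (rule sum.cong[OF refl])
    fix a assume "a \<in> {..<d}"
    show "(\<Sum>b<d. if int a - int b + s = 0 then of_nat q else (0::complex))
      = (if 0 \<le> int a + s \<and> int a + s < int d then of_nat q else 0)"
    proof (cases "0 \<le> int a + s \<and> int a + s < int d")
      case True
      then have "(\<Sum>b<d. if int a - int b + s = 0 then of_nat q else (0::complex))
         = (\<Sum>b<d. if b = nat (int a + s) then of_nat q else 0)"
        by (intro sum.cong) auto
      also have "\<dots> = of_nat q" using True by (subst sum.delta) auto
      finally show ?thesis using True by simp
    qed (auto intro!: sum.neutral)
  qed
  also have "\<dots> = (\<Sum>a\<in>{nat (- s)..<min d (nat (int d - s))}. of_nat q)"
  proof -
    have "{a \<in> {..<d}. 0 \<le> int a + s \<and> int a + s < int d} = {nat (- s)..<min d (nat (int d - s))}"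
      by auto
    then show ?thesis by (subst sum.inter_filter[symmetric]) auto
  qed
  also have "\<dots> = of_nat q * of_nat (d - nat \<bar>s\<bar>)"
  proof -
    have "min d (nat (int d - s)) - nat (- s) = d - nat \<bar>s\<bar>" by linarith
    then show ?thesis by simp
  qed
  finally show ?thesis unfolding sq[unfolded \<theta>_def] \<theta>_def .
qed

text \<open>
  This is \<open>2d sin(d\<theta>) F\<^sub>d(\<theta>)\<close> with \<open>F\<^sub>d\<close> the Fejer kernel: convolution with it differentiates every
  trigonometric polynomial of degree at most \<open>d\<close> at \<open>0\<close>, because the triangular Fourier
  coefficients of \<open>F\<^sub>d\<close>, shifted to be centred at \<open>d\<close> and \<open>-d\<close>, add up to a linear function on \<open>[-d, d]\<close>.
\<close>

definition Riesz_kernel :: "nat \<Rightarrow> real \<Rightarrow> real" where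
  "Riesz_kernel d \<theta> = 2 * sin (real d * \<theta>) * (cmod (\<Sum>a<d. cis (real a * \<theta>)))\<^sup>2"

text \<open>The factor \<open>2 * sin (d * \<theta>)\<close> moves the frequency \<open>j\<close> to
  \<open>j - d\<close> and \<open>j + d\<close>. Both have modulus at most \<open>2 * d\<close>, so
  \<open>3 * d \<le> q\<close> is what \<open>sum_Fejer_cis\<close> asks for.\<close>

lemma sum_Riesz_kernel_cis:
  fixes j :: int and d q :: nat
  assumes "\<bar>j\<bar> \<le> int d" "3 * d \<le> q" "d \<ge> 1"
  shows "(\<Sum>r<q. of_real (Riesz_kernel d (2 * pi * real r / real q)) *
            cis (of_int j * (2 * pi * real r / real q))) = of_nat q * (\<i> * of_int j)"
proof -
  define \<theta> where "\<theta> r = 2 * pi * real r / real q" for r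
  define F where "F r = complex_of_real ((cmod (\<Sum>a<d. cis (real a * \<theta> r)))\<^sup>2)" for r
  have s: "of_real (2 * sin t) = \<i> * (cis (- t) - cis t)" for t
    by (simp add: complex_eq_iff)
  have "of_real (Riesz_kernel d (\<theta> r)) * cis (of_int j * \<theta> r)
      = \<i> * (F r * cis (of_int (j - int d) * \<theta> r) - F r * cis (of_int (j + int d) * \<theta> r))" for r
  proof -
    have "of_real (Riesz_kernel d (\<theta> r)) = \<i> * (cis (- (real d * \<theta> r)) - cis (real d * \<theta> r)) * F r"
      unfolding Riesz_kernel_def F_def of_real_mult s[symmetric] by simp
    moreover have "cis (of_int (j - int d) * \<theta> r) = cis (- (real d * \<theta> r)) * cis (of_int j * \<theta> r)"
        "cis (of_int (j + int d) * \<theta> r) = cis (real d * \<theta> r) * cis (of_int j * \<theta> r)"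
      by (simp_all add: cis_mult algebra_simps)
    ultimately show ?thesis by (simp only:) (simp only: ring_distribs mult_ac)
  qed
  then have "(\<Sum>r<q. of_real (Riesz_kernel d (\<theta> r)) * cis (of_int j * \<theta> r))
     = \<i> * ((\<Sum>r<q. F r * cis (of_int (j - int d) * \<theta> r)) - (\<Sum>r<q. F r * cis (of_int (j + int d) * \<theta> r)))"
    by (simp only: sum_subtractf flip: sum_distrib_left)
  also have "\<dots> = \<i> * (of_nat q * of_nat (d - nat \<bar>j - int d\<bar>) - of_nat q * of_nat (d - nat \<bar>j + int d\<bar>))"
    unfolding F_def \<theta>_def using assms by (subst (1 2) sum_Fejer_cis) auto
  also have "\<dots> = of_nat q * (\<i> * of_int j)"
  proof -
    \<comment> \<open>For \<open>j \<ge> 0\<close> the first term is \<open>j\<close> and the second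
      is truncated to 0; for \<open>j < 0\<close> the first is truncated to 0 and the second is
      \<open>- j\<close>.\<close>
    have "int (d - nat \<bar>j - int d\<bar>) - int (d - nat \<bar>j + int d\<bar>) = j" using assms by linarith
    then have "of_int j = (of_nat (d - nat \<bar>j - int d\<bar>) - of_nat (d - nat \<bar>j + int d\<bar>) :: complex)"
      by (metis of_int_diff of_int_of_nat_eq)
    then show ?thesis by (simp only: ring_distribs mult_ac)
  qed
  finally show ?thesis unfolding \<theta>_def .
qed

text \<open>The right-hand side is \<open>q\<close> times the derivative of \<open>e\<^sup>i\<^sup>j\<^sup>\<theta> sin\<^sup>k \<theta>\<close> at \<open>\<theta> = 0\<close>.\<close>

lemma sum_Riesz_kernel_cis_sin:
  fixes j :: int and d q k :: nat
  assumes "\<bar>j\<bar> + int k \<le> int d" "3 * d \<le> q" "d \<ge> 1"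
  shows "(\<Sum>r<q. of_real (Riesz_kernel d (2 * pi * real r / real q)) *
            cis (of_int j * (2 * pi * real r / real q)) * of_real (sin (2 * pi * real r / real q)) ^ k)
        = of_nat q * (if k = 0 then \<i> * of_int j else if k = 1 then 1 else 0)"
  using assms(1)
proof (induction k arbitrary: j)
  case 0
  then show ?case using sum_Riesz_kernel_cis[OF _ assms(2,3)] by simp
next
  case (Suc k)
  define \<theta> where "\<theta> r = 2 * pi * real r / real q" for r
  define H where "H i r = complex_of_real (Riesz_kernel d (\<theta> r)) * cis (of_int i * \<theta> r) * of_real (sin (\<theta> r)) ^ k"
    for i :: int and r
  have IH: "(\<Sum>r<q. H i r) = of_nat q * (if k = 0 then \<i> * of_int i else if k = 1 then 1 else 0)"
    if "i = j + 1 \<or> i = j - 1" for i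
    unfolding H_def \<theta>_def by (rule Suc.IH) (use that Suc.prems in auto)
  \<comment> \<open>Writing one sine factor through exponentials trades a power of the sine for a
    shift of \<open>j\<close> by one. The sum \<open>\<bar>j\<bar> + k\<close> does not grow, so the
    induction hypothesis applies at both shifted frequencies.\<close>
  have "complex_of_real (Riesz_kernel d (\<theta> r)) * cis (of_int j * \<theta> r) * of_real (sin (\<theta> r)) ^ Suc k
     = (H (j + 1) r - H (j - 1) r) / (2 * \<i>)" for r
  proof -
    have "of_real (sin t) = (cis t - cis (- t)) / (2 * \<i>)" for t
      by (simp add: complex_eq_iff)
    moreover have "cis (of_int (j + 1) * \<theta> r) = cis (of_int j * \<theta> r) * cis (\<theta> r)"
      "cis (of_int (j - 1) * \<theta> r) = cis (of_int j * \<theta> r) * cis (- \<theta> r)"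
      by (simp_all add: cis_mult algebra_simps)
    ultimately show ?thesis
      unfolding H_def power_Suc by (simp only:) (simp only: ring_distribs mult_ac times_divide_eq_right times_divide_eq_left)
  qed
  then have "(\<Sum>r<q. complex_of_real (Riesz_kernel d (\<theta> r)) * cis (of_int j * \<theta> r) * of_real (sin (\<theta> r)) ^ Suc k)
     = ((\<Sum>r<q. H (j + 1) r) - (\<Sum>r<q. H (j - 1) r)) / (2 * \<i>)"
    by (simp only: sum_subtractf flip: sum_divide_distrib)
  also have "\<dots> = of_nat q * (if Suc k = 0 then \<i> * of_int j else if Suc k = 1 then 1 else 0)"
    by (subst (1 2) IH) (auto simp: field_simps)
  finally show ?case unfolding \<theta>_def .
qed

text \<open>Quadrature for differentiating \<open>p (sin \<theta> / 2)\<close> at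
  \<open>\<theta> = 0\<close>, which yields half the linear coefficient of \<open>p\<close>. It is
  exact up to degree \<open>d\<close>. Halving the sine makes the powers of the nodes decay, which
  controls all higher degrees.\<close>

lemma ex_weights_extracting_linear_coefficient:
  fixes d :: nat
  assumes d: "d \<ge> 1"
  obtains w \<rho> :: "nat \<Rightarrow> real" and q :: nat where
    "(\<Sum>r<q. \<bar>w r\<bar>) \<le> 4 * real d" "\<forall>r. \<bar>\<rho> r\<bar> \<le> 1/2"
    "(\<Sum>r<q. w r * \<rho> r) = 1"
    "\<forall>k. k \<noteq> 1 \<longrightarrow> \<bar>\<Sum>r<q. w r * \<rho> r ^ k\<bar> \<le> 4 * real d / 2 ^ d"
proof -
  \<comment> \<open>The smallest number of nodes allowed by
    \<open>sum_Riesz_kernel_cis_sin\<close>.\<close>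
  define q where "q = 3 * d"
  define \<theta> where "\<theta> r = 2 * pi * real r / real q" for r
  \<comment> \<open>The factor 2 compensates the halving in \<open>\<rho>\<close>, so that the first
    moment is 1.\<close>
  define w where "w r = 2 * Riesz_kernel d (\<theta> r) / real q" for r
  define \<rho> where "\<rho> r = sin (\<theta> r) / 2" for r
  have q: "q > 0" using d q_def by simp
  have rho: "\<bar>\<rho> r\<bar> \<le> 1/2" for r unfolding \<rho>_def by simp
  have "complex_of_real (\<Sum>r<q. (cmod (\<Sum>a<d. cis (real a * \<theta> r)))\<^sup>2) = of_real (real q * real d)"
    using sum_Fejer_cis[of 0 d q] d by (simp add: q_def \<theta>_def)
  then have F: "(\<Sum>r<q. (cmod (\<Sum>a<d. cis (real a * \<theta> r)))\<^sup>2) = real q * real d"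
    by (simp only: of_real_eq_iff)
  have "(\<Sum>r<q. \<bar>w r\<bar>) \<le> (\<Sum>r<q. 4 / real q * (cmod (\<Sum>a<d. cis (real a * \<theta> r)))\<^sup>2)"
  proof (rule sum_mono)
    fix r
    have "\<bar>Riesz_kernel d (\<theta> r)\<bar> \<le> 2 * 1 * (cmod (\<Sum>a<d. cis (real a * \<theta> r)))\<^sup>2"
      unfolding Riesz_kernel_def abs_mult by (intro mult_mono) auto
    then show "\<bar>w r\<bar> \<le> 4 / real q * (cmod (\<Sum>a<d. cis (real a * \<theta> r)))\<^sup>2"
      unfolding w_def using q by (simp add: field_simps abs_mult)
  qed
  also have "\<dots> = 4 * real d"
    unfolding sum_distrib_left[symmetric] F using q by simp
  finally have W: "(\<Sum>r<q. \<bar>w r\<bar>) \<le> 4 * real d" .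
  have mom: "(\<Sum>r<q. w r * \<rho> r ^ k) = (if k = 1 then 1 else 0)" if "k \<le> d" for k
  proof -
    have "complex_of_real (\<Sum>r<q. Riesz_kernel d (\<theta> r) * sin (\<theta> r) ^ k)
      = of_real (real q * (if k = 1 then 1 else 0))"
      using sum_Riesz_kernel_cis_sin[of 0 k d q] that d by (simp add: q_def \<theta>_def)
    then have "(\<Sum>r<q. Riesz_kernel d (\<theta> r) * sin (\<theta> r) ^ k) = real q * (if k = 1 then 1 else 0)"
      by (simp only: of_real_eq_iff)
    moreover have "(\<Sum>r<q. w r * \<rho> r ^ k)
        = 2 / (real q * 2 ^ k) * (\<Sum>r<q. Riesz_kernel d (\<theta> r) * sin (\<theta> r) ^ k)"
      unfolding w_def \<rho>_def sum_distrib_left by (intro sum.cong) (auto simp: power_divide)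
    ultimately show ?thesis using q by simp
  qed
  have tail: "\<bar>\<Sum>r<q. w r * \<rho> r ^ k\<bar> \<le> 4 * real d / 2 ^ d" if "k \<noteq> 1" for k
  proof (cases "k \<le> d")
    case True
    then show ?thesis using mom[OF True] that by simp
  next
    case False
    \<comment> \<open>Above degree \<open>d\<close> no cancellation is used, only the total weight
      and the size of the nodes.\<close>
    have "\<bar>\<Sum>r<q. w r * \<rho> r ^ k\<bar> \<le> (\<Sum>r<q. \<bar>w r\<bar> * (1/2) ^ d)"
    proof (rule order.trans[OF sum_abs] sum_mono)+
      fix r
      have "\<bar>\<rho> r\<bar> ^ k \<le> (1/2) ^ k" using rho by (intro power_mono) auto
      also have "\<dots> \<le> (1/2) ^ d" using False by (intro power_decreasing) auto
      finally show "\<bar>w r * \<rho> r ^ k\<bar> \<le> \<bar>w r\<bar> * (1/2) ^ d"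
        unfolding abs_mult power_abs by (intro mult_left_mono) auto
    qed
    also have "\<dots> \<le> 4 * real d * (1/2) ^ d"
      unfolding sum_distrib_right[symmetric] using W by (intro mult_right_mono) auto
    finally show ?thesis by (simp add: power_divide)
  qed
  show ?thesis
    using that[of w q \<rho>] W rho mom[of 1] d tail by simp
qed

section \<open>Coordinates bounded by the norm\<close>

text \<open>Auerbach's argument: choose the columns of \<open>B\<close> from \<open>G\<close> with
  \<open>\<bar>det B\<bar>\<close> maximal. By Cramer's rule a coordinate of \<open>v\<close> is the
  ratio of the determinant with one column replaced by \<open>v\<close> to \<open>det B\<close>,
  hence at most 1 in modulus. The matrix \<open>A\<close> ensures that the maximum is not 0.\<close>

lemma ex_basis_coefficients_le_1:
  fixes G :: "real vec set"
  assumes fin: "finite G" and G: "G \<subseteq> carrier_vec m"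
    and A: "A \<in> carrier_mat m m" "\<And>j. j < m \<Longrightarrow> col A j \<in> G" "det A \<noteq> 0"
  obtains B where "B \<in> carrier_mat m m" "\<forall>j<m. col B j \<in> G"
    "\<forall>v\<in>G. \<exists>a\<in>carrier_vec m. B *\<^sub>v a = v \<and> (\<forall>i<m. \<bar>a $ i\<bar> \<le> 1)"
proof -
  define M where "M = {B \<in> carrier_mat m m. \<forall>j<m. col B j \<in> G}"
  \<comment> \<open>A matrix is determined by its columns, so there are finitely many candidates and
    the maximum is attained.\<close>
  have "M \<subseteq> (\<lambda>g. mat m m (\<lambda>(i,j). g j $ i)) ` ({..<m} \<rightarrow>\<^sub>E G)"
  proof
    fix B assume B: "B \<in> M"
    have "B = mat m m (\<lambda>(i,j). (\<lambda>j\<in>{..<m}. col B j) j $ i)"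
      using B by (intro eq_matI) (auto simp: M_def)
    moreover have "(\<lambda>j\<in>{..<m}. col B j) \<in> {..<m} \<rightarrow>\<^sub>E G" using B by (auto simp: M_def)
    ultimately show "B \<in> (\<lambda>g. mat m m (\<lambda>(i,j). g j $ i)) ` ({..<m} \<rightarrow>\<^sub>E G)" by blast
  qed
  then have finM: "finite M" using fin by (meson finite_PiE finite_imageI finite_lessThan finite_subset)
  have AM: "A \<in> M" using A by (simp add: M_def)
  have "M \<noteq> {}" using AM by blast
  then obtain B where B: "B \<in> M" and Max: "Max ((\<lambda>B. \<bar>det B\<bar>) ` M) = \<bar>det B\<bar>"
    by (rule obtains_MAX[OF finM])
  have max: "\<bar>det B'\<bar> \<le> \<bar>det B\<bar>" if "B' \<in> M" for B'
    unfolding Max[symmetric] using finM that by (intro Max_ge) auto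
  have Bc: "B \<in> carrier_mat m m" using B by (simp add: M_def)
  have det: "det B \<noteq> 0" using max[OF AM] A(3) by auto
  from det_non_zero_imp_unit[OF Bc det, of "()"] obtain B' where
    B': "B' \<in> carrier_mat m m" "B * B' = 1\<^sub>m m"
    unfolding Units_def ring_mat_def by auto
  show ?thesis
  proof (rule that[OF Bc])
    show "\<forall>j<m. col B j \<in> G" using B by (simp add: M_def)
  next
    show "\<forall>v\<in>G. \<exists>a\<in>carrier_vec m. B *\<^sub>v a = v \<and> (\<forall>i<m. \<bar>a $ i\<bar> \<le> 1)"
    proof
      fix v assume v: "v \<in> G"
      then have vc: "v \<in> carrier_vec m" using G by auto
      define a where "a = B' *\<^sub>v v"
      have ac: "a \<in> carrier_vec m" using B'(1) vc by (simp add: a_def)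
      have Ba: "B *\<^sub>v a = v"
        unfolding a_def using Bc B' vc by (simp add: assoc_mult_mat_vec[symmetric])
      have "\<bar>a $ i\<bar> \<le> 1" if i: "i < m" for i
      proof -
        have "col (replace_col B v i) j = (if j = i then v else col B j)" if "j < m" for j
          using that Bc vc by (intro eq_vecI) (auto simp: replace_col_def)
        moreover have "replace_col B v i \<in> carrier_mat m m"
          using Bc by (simp add: replace_col_def)
        ultimately have "replace_col B v i \<in> M" using B v by (simp add: M_def)
        from max[OF this] have "\<bar>a $ i * det B\<bar> \<le> \<bar>det B\<bar>"
          using cramer_lemma_mat[OF Bc ac i] Ba by simp
        then show ?thesis using det by (simp add: abs_mult)
      qed
      then show "\<exists>a\<in>carrier_vec m. B *\<^sub>v a = v \<and> (\<forall>i<m. \<bar>a $ i\<bar> \<le> 1)" using ac Ba by blast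
    qed
  qed
qed

lemma is_normD:
  assumes "is_norm m N"
  shows "\<And>v. v \<in> carrier_vec m \<Longrightarrow> 0 \<le> N v"
    and "\<And>v. v \<in> carrier_vec m \<Longrightarrow> N v = 0 \<longleftrightarrow> v = 0\<^sub>v m"
    and "\<And>a v. v \<in> carrier_vec m \<Longrightarrow> N (a \<cdot>\<^sub>v v) = \<bar>a\<bar> * N v"
    and "\<And>v w. v \<in> carrier_vec m \<Longrightarrow> w \<in> carrier_vec m \<Longrightarrow> N (v + w) \<le> N v + N w"
  using assms unfolding is_norm_def by auto

lemma norm_combination_le:
  assumes N: "is_norm m N" and "finite A" and g: "\<And>y. y \<in> A \<Longrightarrow> g y \<in> carrier_vec m"
  shows "N (vec m (\<lambda>i. \<Sum>y\<in>A. a y * g y $ i)) \<le> (\<Sum>y\<in>A. \<bar>a y\<bar> * N (g y))"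
  using assms(2) g
proof (induction A rule: finite_induct)
  case empty
  have "vec m (\<lambda>i. 0::real) = 0\<^sub>v m" by auto
  then show ?case using is_normD(2)[OF N, of "0\<^sub>v m"] by simp
next
  case (insert z A)
  define u where "u = vec m (\<lambda>i. \<Sum>y\<in>A. a y * g y $ i)"
  have z: "g z \<in> carrier_vec m" using insert by auto
  have "vec m (\<lambda>i. \<Sum>y\<in>insert z A. a y * g y $ i) = a z \<cdot>\<^sub>v g z + u"
    using insert(1,2) z by (intro eq_vecI) (auto simp: u_def)
  also have "N \<dots> \<le> N (a z \<cdot>\<^sub>v g z) + N u"
    using z by (intro is_normD(4)[OF N]) (auto simp: u_def)
  also have "N (a z \<cdot>\<^sub>v g z) = \<bar>a z\<bar> * N (g z)" by (rule is_normD(3)[OF N z])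
  also have "N u \<le> (\<Sum>y\<in>A. \<bar>a y\<bar> * N (g y))" unfolding u_def using insert by auto
  finally show ?case using insert(1,2) by simp
qed

text \<open>
  Only the finitely many vectors of \<open>F\<close> need bounded coordinates, so Auerbach's argument
  maximises over a finite set and no compactness of the unit ball is used.
\<close>

lemma ex_bounded_coordinates:
  assumes N: "is_norm m N" and fin: "finite F" and F: "F \<subseteq> carrier_vec m"
  obtains b :: "nat \<Rightarrow> real vec" and a :: "real vec \<Rightarrow> nat \<Rightarrow> real" where
    "\<forall>i<m. b i \<in> carrier_vec m \<and> N (b i) = 1"
    "\<forall>v\<in>F. (\<forall>i<m. \<bar>a v i\<bar> \<le> N v) \<and> (\<forall>k<m. v $ k = (\<Sum>i<m. a v i * b i $ k))"
proof -
  define nrm where "nrm v = (1 / N v) \<cdot>\<^sub>v v" for v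
  \<comment> \<open>The vectors of \<open>F\<close> need not span the space, so the unit vectors are
    added; everything is normalised, which requires dropping 0.\<close>
  define G where "G = nrm ` ((F \<union> unit_vec m ` {..<m}) - {0\<^sub>v m})"
  have pos: "N v > 0" if "v \<in> carrier_vec m" "v \<noteq> 0\<^sub>v m" for v
    using is_normD(1,2)[OF N that(1)] that(2) by force
  have Gc: "G \<subseteq> carrier_vec m" using F by (auto simp: G_def nrm_def)
  have Gn: "N v = 1" if "v \<in> G" for v
  proof -
    from that obtain u where "u \<in> (F \<union> unit_vec m ` {..<m}) - {0\<^sub>v m}" and vu: "v = nrm u"
      unfolding G_def by (rule imageE)
    then have u: "u \<in> carrier_vec m" "u \<noteq> 0\<^sub>v m" using F by auto
    then show ?thesis using pos[OF u(1,2)] is_normD(3)[OF N u(1), of "1 / N u"] by (simp add: vu nrm_def)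
  qed
  \<comment> \<open>The normalised unit vectors as columns: a diagonal matrix with nonzero diagonal
    entries.\<close>
  define A where "A = mat m m (\<lambda>(i,j). if i = j then 1 / N (unit_vec m j) else 0)"
  have u0: "unit_vec m j \<noteq> (0\<^sub>v m :: real vec)" if "j < m" for j
    using that by (metis index_unit_vec(2) index_zero_vec(1) zero_neq_one)
  have Ac: "A \<in> carrier_mat m m" by (simp add: A_def)
  have finG: "finite G" using fin by (simp add: G_def)
  have Acol: "col A j \<in> G" if "j < m" for j
  proof -
    have "col A j = nrm (unit_vec m j)"
      using that by (intro eq_vecI) (auto simp: A_def nrm_def)
    then show ?thesis using u0[OF that] that by (auto simp: G_def)
  qed
  have "upper_triangular A" by (auto simp: A_def)
  then have "det A = prod_list (diag_mat A)" by (rule det_upper_triangular) (auto simp: A_def)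
  moreover have "prod_list (diag_mat A) \<noteq> 0"
  proof -
    have "N (unit_vec m i) \<noteq> 0" if "i < m" for i using pos[OF _ u0[OF that]] by force
    then show ?thesis by (auto simp: prod_list_zero_iff diag_mat_def A_def)
  qed
  ultimately have Adet: "det A \<noteq> 0" by simp
  obtain B where B: "B \<in> carrier_mat m m" "\<forall>j<m. col B j \<in> G"
    and ex: "\<forall>v\<in>G. \<exists>a\<in>carrier_vec m. B *\<^sub>v a = v \<and> (\<forall>i<m. \<bar>a $ i\<bar> \<le> 1)"
    by (rule ex_basis_coefficients_le_1[OF finG Gc Ac Acol Adet])
  have "\<exists>a. \<forall>v\<in>F. (\<forall>i<m. \<bar>a v i\<bar> \<le> N v) \<and> (\<forall>k<m. v $ k = (\<Sum>i<m. a v i * col B i $ k))"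
  proof (rule bchoice, rule ballI)
    fix v assume v: "v \<in> F"
    then have vc: "v \<in> carrier_vec m" using F by auto
    show "\<exists>c. (\<forall>i<m. \<bar>c i\<bar> \<le> N v) \<and> (\<forall>k<m. v $ k = (\<Sum>i<m. c i * col B i $ k))"
    proof (cases "v = 0\<^sub>v m")
      case True
      then show ?thesis using is_normD(1)[OF N vc] by (intro exI[of _ "\<lambda>_. 0"]) auto
    next
      case False
      then have "nrm v \<in> G" using v by (auto simp: G_def)
      then obtain c where c: "c \<in> carrier_vec m" "B *\<^sub>v c = nrm v" "\<forall>i<m. \<bar>c $ i\<bar> \<le> 1"
        using bspec[OF ex] by blast
      note p = pos[OF vc False]
      have "v $ k = (\<Sum>i<m. N v * c $ i * col B i $ k)" if k: "k < m" for k
      proof -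
        have "v $ k = N v * (B *\<^sub>v c) $ k" using p k vc by (simp add: c(2) nrm_def)
        also have "(B *\<^sub>v c) $ k = (\<Sum>i<m. c $ i * col B i $ k)"
          using B(1) c(1) k by (auto simp: scalar_prod_def lessThan_atLeast0 mult.commute intro!: sum.cong)
        finally show ?thesis by (simp add: sum_distrib_left mult.assoc)
      qed
      moreover have "\<bar>N v * c $ i\<bar> \<le> N v" if "i < m" for i
        using c(3) that p by (simp add: abs_mult)
      ultimately show ?thesis by (intro exI[of _ "\<lambda>i. N v * c $ i"] conjI allI impI)
    qed
  qed
  then obtain a where a: "\<forall>v\<in>F. (\<forall>i<m. \<bar>a v i\<bar> \<le> N v) \<and> (\<forall>k<m. v $ k = (\<Sum>i<m. a v i * col B i $ k))" ..
  show ?thesis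
  proof (rule that[OF _ a], intro allI impI)
    fix i assume "i < m"
    then have "col B i \<in> G" using B(2) by blast
    then show "col B i \<in> carrier_vec m \<and> N (col B i) = 1" using Gn Gc by blast
  qed
qed

section \<open>Operators on the cube\<close>

lemma L2_set_sum_le:
  "L2_set (\<lambda>x. \<Sum>i\<in>I. g i x) A \<le> (\<Sum>i\<in>I. L2_set (g i) A)"
proof (induction I rule: infinite_finite_induct)
  case (insert i I)
  have "L2_set (\<lambda>x. \<Sum>i\<in>insert i I. g i x) A = L2_set (\<lambda>x. g i x + (\<Sum>i\<in>I. g i x)) A"
    using insert by simp
  also have "\<dots> \<le> L2_set (g i) A + L2_set (\<lambda>x. \<Sum>i\<in>I. g i x) A"
    by (rule L2_set_triangle_ineq)
  finally show ?case using insert by simp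
qed (simp_all add: L2_set_0')

text \<open>Cauchy-Schwarz with weights \<open>k x y\<close> and unit row sums bounds the square of
  an average by the average of the squares. Summing over \<open>x\<close> and using unit column sums
  finishes.\<close>

lemma L2_set_doubly_stochastic_le:
  assumes fin: "finite A" and nn: "\<And>x y. x \<in> A \<Longrightarrow> y \<in> A \<Longrightarrow> 0 \<le> k x y"
    and row: "\<And>x. x \<in> A \<Longrightarrow> (\<Sum>y\<in>A. k x y) = 1"
    and col: "\<And>y. y \<in> A \<Longrightarrow> (\<Sum>x\<in>A. k x y) = 1"
  shows "L2_set (\<lambda>x. \<Sum>y\<in>A. k x y * u y) A \<le> L2_set u A"
proof -
  have "(\<Sum>y\<in>A. k x y * u y)\<^sup>2 \<le> (\<Sum>y\<in>A. k x y * (u y)\<^sup>2)" if x: "x \<in> A" for x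
  proof -
    have "(\<Sum>y\<in>A. k x y * u y)\<^sup>2 = (\<Sum>y\<in>A. sqrt (k x y) * (sqrt (k x y) * u y))\<^sup>2"
      using nn[OF x] by (intro arg_cong[of _ _ "\<lambda>t. t\<^sup>2"] sum.cong) (auto simp flip: mult.assoc)
    also have "\<dots> \<le> (\<Sum>y\<in>A. (sqrt (k x y))\<^sup>2) * (\<Sum>y\<in>A. (sqrt (k x y) * u y)\<^sup>2)"
      by (rule Cauchy_Schwarz_ineq_sum)
    also have "\<dots> = (\<Sum>y\<in>A. k x y) * (\<Sum>y\<in>A. k x y * (u y)\<^sup>2)"
      using nn[OF x] by (simp add: power_mult_distrib cong: sum.cong)
    finally show ?thesis by (simp add: row[OF x])
  qed
  then have "(\<Sum>x\<in>A. (\<Sum>y\<in>A. k x y * u y)\<^sup>2) \<le> (\<Sum>x\<in>A. \<Sum>y\<in>A. k x y * (u y)\<^sup>2)"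
    by (rule sum_mono)
  also have "\<dots> = (\<Sum>y\<in>A. (\<Sum>x\<in>A. k x y) * (u y)\<^sup>2)"
    by (subst sum.swap) (simp add: sum_distrib_right)
  also have "\<dots> = (\<Sum>y\<in>A. (u y)\<^sup>2)" by (simp add: col)
  finally show ?thesis unfolding L2_set_def by simp
qed

section \<open>The noise operator and its contraction property\<close>

definition noise_kernel :: "nat \<Rightarrow> real \<Rightarrow> (nat \<Rightarrow> real) \<Rightarrow> (nat \<Rightarrow> real) \<Rightarrow> real" where
  "noise_kernel n \<rho> x y = (\<Prod>j\<in>{1..n}. 1 + \<rho> * (x j * y j))"

lemma noise_kernel_characters:
  "noise_kernel n \<rho> x y = (\<Sum>S\<in>Pow {1..n}. \<rho> ^ card S * (character S x * character S y))"
  unfolding noise_kernel_def using sum_Pow_prod[of "{1..n}" "\<lambda>j. \<rho> * (x j * y j)"]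
  by (simp add: prod.distrib character_def)

lemma noise_kernel_nonneg:
  assumes "\<bar>\<rho>\<bar> \<le> 1" "x \<in> cube n" "y \<in> cube n"
  shows "0 \<le> noise_kernel n \<rho> x y"
  unfolding noise_kernel_def
proof (rule prod_nonneg)
  fix j assume "j \<in> {1..n}"
  then have "x j \<in> {-1, 1}" "y j \<in> {-1, 1}" using assms unfolding cube_def by (meson PiE_mem)+
  then show "0 \<le> 1 + \<rho> * (x j * y j)" using assms(1) by auto
qed

lemma noise_kernel_commute: "noise_kernel n \<rho> x y = noise_kernel n \<rho> y x"
  unfolding noise_kernel_def by (simp add: mult.commute)

lemma sum_noise_kernel: "(\<Sum>y\<in>cube n. noise_kernel n \<rho> x y) = 2 ^ n"
proof -
  \<comment> \<open>The constant 1 is written as \<open>character {} y\<close>, so that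
    orthogonality leaves only the empty set.\<close>
  have "(\<Sum>y\<in>cube n. noise_kernel n \<rho> x y)
     = (\<Sum>S\<in>Pow {1..n}. \<rho> ^ card S * character S x * (\<Sum>y\<in>cube n. character S y * character {} y))"
    unfolding noise_kernel_characters
    by (subst sum.swap) (simp add: sum_distrib_left mult.assoc character_def)
  also have "\<dots> = (\<Sum>S\<in>Pow {1..n}. if S = {} then 2 ^ n else 0)"
    by (rule sum.cong) (auto simp: character_orthogonal, auto simp: character_def)
  finally show ?thesis by simp
qed

text \<open>The kernel is a density relative to the uniform measure, hence the division by
  \<open>2 ^ n\<close>. Its symmetry turns the row sums into the column sums.\<close>

lemma L2_set_noise_le:
  assumes "\<bar>\<rho>\<bar> \<le> 1"
  shows "L2_set (\<lambda>x. \<Sum>y\<in>cube n. noise_kernel n \<rho> x y / 2 ^ n * u y) (cube n) \<le> L2_set u (cube n)"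
proof (rule L2_set_doubly_stochastic_le)
  show "(\<Sum>y\<in>cube n. noise_kernel n \<rho> x y / 2 ^ n) = 1" for x
    by (simp add: sum_noise_kernel flip: sum_divide_distrib)
  then show "(\<Sum>x\<in>cube n. noise_kernel n \<rho> x y / 2 ^ n) = 1" for y
    by (subst noise_kernel_commute)
qed (auto simp: finite_cube noise_kernel_nonneg assms)

section \<open>Parseval's identity and Fourier multipliers on scalar functions\<close>

lemma Parseval_cube:
  "(\<Sum>x\<in>cube n. (\<Sum>S\<in>Pow {1..n}. b S * character S x)\<^sup>2) = 2 ^ n * (\<Sum>S\<in>Pow {1..n}. (b S)\<^sup>2)"
proof -
  let ?P = "Pow {1..n}"
  have "(\<Sum>x\<in>cube n. (\<Sum>S\<in>?P. b S * character S x)\<^sup>2)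
     = (\<Sum>x\<in>cube n. \<Sum>S\<in>?P. \<Sum>T\<in>?P. b S * b T * (character S x * character T x))"
    unfolding power2_eq_square sum_product by (simp add: mult_ac)
  also have "\<dots> = (\<Sum>S\<in>?P. \<Sum>T\<in>?P. \<Sum>x\<in>cube n. b S * b T * (character S x * character T x))"
    by (subst sum.swap, rule sum.cong[OF refl], rule sum.swap)
  also have "\<dots> = (\<Sum>S\<in>?P. \<Sum>T\<in>?P. if S = T then b S * b T * 2 ^ n else 0)"
    unfolding sum_distrib_left[symmetric]
    by (intro sum.cong[OF refl]) (auto simp: character_orthogonal)
  also have "\<dots> = 2 ^ n * (\<Sum>S\<in>?P. (b S)\<^sup>2)"
    by (simp add: sum_distrib_left power2_eq_square mult_ac)
  finally show ?thesis .
qed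

text \<open>The kernel multiplies the Fourier coefficient of \<open>u\<close> at \<open>S\<close> by
  \<open>c S\<close>, so Parseval before and after reduces the bound to one on each
  coefficient.\<close>

lemma L2_set_multiplier_le:
  assumes c: "\<And>S. S \<subseteq> {1..n} \<Longrightarrow> \<bar>c S\<bar> \<le> \<epsilon>"
  shows "L2_set (\<lambda>x. \<Sum>y\<in>cube n. (\<Sum>S\<in>Pow {1..n}. c S * (character S x * character S y)) / 2 ^ n * u y) (cube n)
     \<le> \<epsilon> * L2_set u (cube n)"
proof -
  let ?P = "Pow {1..n}"
  define h where "h S = (\<Sum>y\<in>cube n. u y * character S y) / 2 ^ n" for S
  have \<epsilon>: "0 \<le> \<epsilon>" using order.trans[OF abs_ge_zero c[of "{}"]] by simp
  \<comment> \<open>Stated for an arbitrary multiplier \<open>d\<close>, because the constant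
    multiplier 1 gives the inversion formula for \<open>u\<close>.\<close>
  have M: "(\<Sum>y\<in>cube n. (\<Sum>S\<in>?P. d S * (character S x * character S y)) / 2 ^ n * u y)
      = (\<Sum>S\<in>?P. (d S * h S) * character S x)" for d x
    unfolding h_def sum_distrib_left sum_distrib_right sum_divide_distrib
    by (subst sum.swap) (simp add: mult_ac)
  have u: "u x = (\<Sum>S\<in>?P. h S * character S x)" if x: "x \<in> cube n" for x
  proof -
    have "(\<Sum>S\<in>?P. h S * character S x)
       = (\<Sum>y\<in>cube n. (\<Sum>S\<in>?P. character S x * character S y) / 2 ^ n * u y)"
      using M[of "\<lambda>_. 1" x] by simp
    also have "\<dots> = (\<Sum>y\<in>cube n. if y = x then u y else 0)"
      by (rule sum.cong) (auto simp: sum_characters[OF x] simp del: One_nat_def)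
    finally show ?thesis using x finite_cube by simp
  qed
  have "(\<Sum>x\<in>cube n. (\<Sum>S\<in>?P. (c S * h S) * character S x)\<^sup>2) = 2 ^ n * (\<Sum>S\<in>?P. (c S * h S)\<^sup>2)"
    by (rule Parseval_cube)
  also have "\<dots> \<le> 2 ^ n * (\<Sum>S\<in>?P. \<epsilon>\<^sup>2 * (h S)\<^sup>2)"
  proof (intro mult_left_mono sum_mono)
    fix S assume "S \<in> ?P"
    then have "(c S)\<^sup>2 \<le> \<epsilon>\<^sup>2" using c[of S] \<epsilon> by (simp add: abs_le_square_iff[symmetric])
    then show "(c S * h S)\<^sup>2 \<le> \<epsilon>\<^sup>2 * (h S)\<^sup>2" by (simp add: power_mult_distrib mult_right_mono)
  qed simp
  also have "\<dots> = \<epsilon>\<^sup>2 * (\<Sum>x\<in>cube n. (\<Sum>S\<in>?P. h S * character S x)\<^sup>2)"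
    unfolding Parseval_cube sum_distrib_left[symmetric] by simp
  also have "\<dots> = \<epsilon>\<^sup>2 * (\<Sum>x\<in>cube n. (u x)\<^sup>2)"
    by (simp add: u cong: sum.cong)
  finally have "(\<Sum>x\<in>cube n. (\<Sum>S\<in>?P. (c S * h S) * character S x)\<^sup>2) \<le> \<epsilon>\<^sup>2 * (\<Sum>x\<in>cube n. (u x)\<^sup>2)" .
  then have "sqrt (\<Sum>x\<in>cube n. (\<Sum>S\<in>?P. (c S * h S) * character S x)\<^sup>2) \<le> sqrt (\<epsilon>\<^sup>2 * (\<Sum>x\<in>cube n. (u x)\<^sup>2))"
    by (rule real_sqrt_le_mono)
  then show ?thesis
    unfolding L2_set_def M using \<epsilon> by (simp add: real_sqrt_mult)
qed

section \<open>The linear part as a kernel operator, and its estimate\<close>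

lemma linear_kernel_characters:
  fixes x y :: "nat \<Rightarrow> real"
  shows "(\<Sum>j\<in>{1..n}. x j * y j)
    = (\<Sum>S\<in>Pow {1..n}. (if card S = 1 then 1 else 0) * (character S x * character S y))"
proof -
  have "(\<Sum>S\<in>Pow {1..n}. (if card S = 1 then 1 else 0) * (character S x * character S y))
     = (\<Sum>S\<in>(\<lambda>j. {j}) ` {1..n}. (if card S = 1 then 1 else 0) * (character S x * character S y))"
    by (rule sum.mono_neutral_right) (auto simp: card_1_singleton_iff)
  also have "\<dots> = (\<Sum>j\<in>{1..n}. x j * y j)"
    by (subst sum.reindex) (auto simp: character_def)
  finally show ?thesis by simp
qed

lemma index_linear_part:
  assumes f: "f \<in> cube n \<rightarrow> carrier_vec m" and i: "i < m"
  shows "linear_part n m f x $ i = (\<Sum>y\<in>cube n. (\<Sum>j\<in>{1..n}. x j * y j) / 2 ^ n * f y $ i)"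
proof -
  have c: "fourier_coeff n m f {j} = vec m (\<lambda>i. (\<Sum>y\<in>cube n. f y $ i * y j) / 2 ^ n)"
    if "j \<in> {1..n}" for j
    using fourier_coeff_eq[OF f, of "{j}"] that by (simp add: character_def)
  then have "linear_part n m f x $ i = (\<Sum>j\<in>{1..n}. (x j \<cdot>\<^sub>v fourier_coeff n m f {j}) $ i)"
    unfolding linear_part_def using i by (subst index_finsum_vec) auto
  also have "\<dots> = (\<Sum>j\<in>{1..n}. \<Sum>y\<in>cube n. x j * y j / 2 ^ n * f y $ i)"
    using i by (intro sum.cong) (auto simp: c sum_distrib_left sum_divide_distrib mult_ac)
  also have "\<dots> = (\<Sum>y\<in>cube n. (\<Sum>j\<in>{1..n}. x j * y j) / 2 ^ n * f y $ i)"
    by (subst sum.swap) (simp add: sum_distrib_right sum_divide_distrib)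
  finally show ?thesis .
qed

lemma linear_part_carrier:
  assumes "f \<in> cube n \<rightarrow> carrier_vec m"
  shows "linear_part n m f x \<in> carrier_vec m"
  unfolding linear_part_def
  by (intro finsum_vec_closed) (auto simp: fourier_coeff_eq[OF assms])

text \<open>The two terms of the constant come from two parts of the linear kernel. The combination
  \<open>K\<close> of noise kernels acts on the scalar function \<open>N (f y)\<close> as a
  combination of contractions. The remainder \<open>R\<close> has no sign, so it is applied to each
  of the \<open>m\<close> scalar coordinates.\<close>

lemma L2_set_linear_part_le:
  assumes N: "is_norm m N" and f: "f \<in> cube n \<rightarrow> carrier_vec m" and d: "d \<ge> 1"
  shows "L2_set (\<lambda>x. N (linear_part n m f x)) (cube n)
    \<le> (4 * real d + real m * (4 * real d / 2 ^ d)) * L2_set (\<lambda>x. N (f x)) (cube n)"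
proof -
  let ?Q = "cube n"
  define \<epsilon> where "\<epsilon> = 4 * real d / 2 ^ d"
  define L where "L = L2_set (\<lambda>x. N (f x)) ?Q"
  have fc: "f y \<in> carrier_vec m" if "y \<in> ?Q" for y using f that by auto
  obtain w \<rho> :: "nat \<Rightarrow> real" and q :: nat where
    w: "(\<Sum>r<q. \<bar>w r\<bar>) \<le> 4 * real d" and \<rho>: "\<forall>r. \<bar>\<rho> r\<bar> \<le> 1/2"
    and one: "(\<Sum>r<q. w r * \<rho> r) = 1"
    and tail: "\<forall>k. k \<noteq> 1 \<longrightarrow> \<bar>\<Sum>r<q. w r * \<rho> r ^ k\<bar> \<le> 4 * real d / 2 ^ d"
    by (rule ex_weights_extracting_linear_coefficient[OF d])
  \<comment> \<open>The defect of the quadrature: the linear kernel has multiplier 1 on singletons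
    and 0 elsewhere, and \<open>K\<close> has the moment of order \<open>card S\<close>. The defect
    vanishes on singletons by \<open>one\<close> and is bounded by \<open>tail\<close>
    otherwise.\<close>
  define c where "c S = (if card S = 1 then 1 else 0) - (\<Sum>r<q. w r * \<rho> r ^ card S)" for S :: "nat set"
  have \<epsilon>: "\<bar>c S\<bar> \<le> \<epsilon>" for S
    using one tail[rule_format, of "card S"] by (auto simp: c_def \<epsilon>_def)
  define K where "K x y = (\<Sum>r<q. w r * noise_kernel n (\<rho> r) x y) / 2 ^ n" for x y
  define R where "R x y = (\<Sum>S\<in>Pow {1..n}. c S * (character S x * character S y)) / 2 ^ n" for x y
  have split: "(\<Sum>j\<in>{1..n}. x j * y j) / 2 ^ n = K x y + R x y" for x y
  proof -
    have "(\<Sum>r<q. w r * noise_kernel n (\<rho> r) x y)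
       = (\<Sum>S\<in>Pow {1..n}. (\<Sum>r<q. w r * \<rho> r ^ card S) * (character S x * character S y))"
      unfolding noise_kernel_characters sum_distrib_left sum_distrib_right
      by (subst sum.swap) (simp add: mult_ac)
    then show ?thesis
      unfolding linear_kernel_characters K_def R_def c_def add_divide_distrib[symmetric]
      by (simp add: left_diff_distrib sum_subtractf)
  qed
  have finF: "finite (f ` ?Q)" and Fc: "f ` ?Q \<subseteq> carrier_vec m" using finite_cube fc by auto
  obtain b :: "nat \<Rightarrow> real vec" and a :: "real vec \<Rightarrow> nat \<Rightarrow> real" where
    b: "\<forall>i<m. b i \<in> carrier_vec m \<and> N (b i) = 1"
    and a: "\<forall>v\<in>f ` ?Q. (\<forall>i<m. \<bar>a v i\<bar> \<le> N v) \<and> (\<forall>k<m. v $ k = (\<Sum>i<m. a v i * b i $ k))"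
    by (rule ex_bounded_coordinates[OF N finF Fc])
  \<comment> \<open>\<open>G\<close> and \<open>H\<close> are the pointwise bounds for the
    contributions of \<open>K\<close> and \<open>R\<close>. In \<open>G\<close> the absolute value
    falls on the weights alone, because the noise kernels are nonnegative.\<close>
  define G where "G x = (\<Sum>r<q. \<bar>w r\<bar> * (\<Sum>y\<in>?Q. noise_kernel n (\<rho> r) x y / 2 ^ n * N (f y)))" for x
  define H where "H x = (\<Sum>i<m. \<bar>\<Sum>y\<in>?Q. R x y * a (f y) i\<bar>)" for x
  have pt: "N (linear_part n m f x) \<le> G x + H x" if x: "x \<in> ?Q" for x
  proof -
    define v where "v = vec m (\<lambda>k. \<Sum>y\<in>?Q. K x y * f y $ k)"
    define v' where "v' = vec m (\<lambda>k. \<Sum>i\<in>{..<m}. (\<Sum>y\<in>?Q. R x y * a (f y) i) * b i $ k)"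
    have "linear_part n m f x = v + v'"
    proof (rule eq_vecI)
      show "dim_vec (linear_part n m f x) = dim_vec (v + v')"
        using linear_part_carrier[OF f] by (simp add: v'_def)
      fix k assume "k < dim_vec (v + v')"
      then have k: "k < m" by (simp add: v'_def)
      have "(\<Sum>y\<in>?Q. R x y * f y $ k) = (\<Sum>y\<in>?Q. \<Sum>i<m. R x y * a (f y) i * b i $ k)"
        using a k by (intro sum.cong) (auto simp: sum_distrib_left mult.assoc)
      also have "\<dots> = v' $ k"
        using k by (subst sum.swap) (simp add: v'_def sum_distrib_right)
      finally have "(\<Sum>y\<in>?Q. R x y * f y $ k) = v' $ k" .
      then show "linear_part n m f x $ k = (v + v') $ k"
        unfolding index_linear_part[OF f k] split distrib_right sum.distrib
        using k by (simp add: v_def v'_def)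
    qed
    also have "N \<dots> \<le> N v + N v'" by (rule is_normD(4)[OF N]) (auto simp: v_def v'_def)
    also have "N v \<le> (\<Sum>y\<in>?Q. \<bar>K x y\<bar> * N (f y))"
      unfolding v_def by (rule norm_combination_le[OF N finite_cube fc])
    also have "\<dots> \<le> (\<Sum>y\<in>?Q. (\<Sum>r<q. \<bar>w r\<bar> * (noise_kernel n (\<rho> r) x y / 2 ^ n)) * N (f y))"
    proof (intro sum_mono mult_right_mono)
      fix y assume y: "y \<in> ?Q"
      show "0 \<le> N (f y)" using is_normD(1)[OF N fc[OF y]] .
      have "\<bar>K x y\<bar> \<le> (\<Sum>r<q. \<bar>w r * noise_kernel n (\<rho> r) x y / 2 ^ n\<bar>)"
        unfolding K_def sum_divide_distrib by (rule sum_abs)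
      also have "\<dots> = (\<Sum>r<q. \<bar>w r\<bar> * (noise_kernel n (\<rho> r) x y / 2 ^ n))"
      proof (rule sum.cong[OF refl])
        fix r
        have "\<bar>\<rho> r\<bar> \<le> 1" using \<rho>[rule_format, of r] by linarith
        then show "\<bar>w r * noise_kernel n (\<rho> r) x y / 2 ^ n\<bar> = \<bar>w r\<bar> * (noise_kernel n (\<rho> r) x y / 2 ^ n)"
          using noise_kernel_nonneg[OF _ x y] by (simp add: abs_mult)
      qed
      finally show "\<bar>K x y\<bar> \<le> (\<Sum>r<q. \<bar>w r\<bar> * (noise_kernel n (\<rho> r) x y / 2 ^ n))" .
    qed
    also have "\<dots> = G x"
      unfolding G_def sum_distrib_left sum_distrib_right by (subst sum.swap) (simp add: mult_ac)
    also have "N v' \<le> (\<Sum>i\<in>{..<m}. \<bar>\<Sum>y\<in>?Q. R x y * a (f y) i\<bar> * N (b i))"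
      unfolding v'_def by (rule norm_combination_le[OF N]) (auto simp: b)
    also have "\<dots> = H x" unfolding H_def by (simp add: b)
    finally show ?thesis by simp
  qed
  have "L2_set (\<lambda>x. N (linear_part n m f x)) ?Q \<le> L2_set (\<lambda>x. G x + H x) ?Q"
    using pt is_normD(1)[OF N linear_part_carrier[OF f]] by (intro L2_set_mono) auto
  also have "\<dots> \<le> L2_set G ?Q + L2_set H ?Q" by (rule L2_set_triangle_ineq)
  also have "L2_set G ?Q \<le> (\<Sum>r<q. L2_set (\<lambda>x. \<bar>w r\<bar> * (\<Sum>y\<in>?Q. noise_kernel n (\<rho> r) x y / 2 ^ n * N (f y))) ?Q)"
    unfolding G_def by (rule L2_set_sum_le)
  also have "\<dots> \<le> (\<Sum>r<q. \<bar>w r\<bar> * L)"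
  proof (rule sum_mono)
    fix r
    have "\<bar>\<rho> r\<bar> \<le> 1" using \<rho>[rule_format, of r] by linarith
    then show "L2_set (\<lambda>x. \<bar>w r\<bar> * (\<Sum>y\<in>?Q. noise_kernel n (\<rho> r) x y / 2 ^ n * N (f y))) ?Q \<le> \<bar>w r\<bar> * L"
      unfolding L_def L2_set_right_distrib[OF abs_ge_zero, symmetric]
      by (intro mult_left_mono L2_set_noise_le abs_ge_zero)
  qed
  also have "\<dots> \<le> 4 * real d * L"
    unfolding sum_distrib_right[symmetric] using w by (intro mult_right_mono) (auto simp: L_def)
  also have "L2_set H ?Q \<le> (\<Sum>i<m. L2_set (\<lambda>x. \<bar>\<Sum>y\<in>?Q. R x y * a (f y) i\<bar>) ?Q)"
    unfolding H_def by (rule L2_set_sum_le)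
  also have "\<dots> \<le> (\<Sum>i<m. \<epsilon> * L)"
  proof (rule sum_mono)
    fix i assume i: "i \<in> {..<m}"
    \<comment> \<open>Each coordinate is a scalar function, so the multiplier bound applies; it is
      dominated pointwise by \<open>N (f y)\<close>, so its norm is at most
      \<open>L\<close>.\<close>
    have "L2_set (\<lambda>x. \<bar>\<Sum>y\<in>?Q. R x y * a (f y) i\<bar>) ?Q = L2_set (\<lambda>x. \<Sum>y\<in>?Q. R x y * a (f y) i) ?Q"
      by (simp add: L2_set_def)
    also have "\<dots> \<le> \<epsilon> * L2_set (\<lambda>y. a (f y) i) ?Q"
      unfolding R_def by (rule L2_set_multiplier_le) (rule \<epsilon>)
    also have "L2_set (\<lambda>y. a (f y) i) ?Q = L2_set (\<lambda>y. \<bar>a (f y) i\<bar>) ?Q"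
      by (simp add: L2_set_def)
    also have "\<epsilon> * \<dots> \<le> \<epsilon> * L"
      unfolding L_def using a i by (intro mult_left_mono L2_set_mono) (auto simp: \<epsilon>_def)
    finally show "L2_set (\<lambda>x. \<bar>\<Sum>y\<in>?Q. R x y * a (f y) i\<bar>) ?Q \<le> \<epsilon> * L" by simp
  qed
  finally show ?thesis by (simp add: L_def \<epsilon>_def algebra_simps)
qed

section \<open>Normalisation and choice of the degree\<close>

lemma sqrt_cube_expectation_square:
  "sqrt (cube_expectation n (\<lambda>x. (h x)\<^sup>2)) = L2_set h (cube n) / sqrt (2 ^ n)"
proof -
  have "cube n \<noteq> {}" using card_cube[of n] by force
  then have "cube_expectation n (\<lambda>x. (h x)\<^sup>2) = (\<Sum>x\<in>cube n. (h x)\<^sup>2) / 2 ^ n"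
    unfolding cube_expectation_def by (subst integral_pmf_of_set) (auto simp: finite_cube card_cube)
  then show ?thesis by (simp add: L2_set_def real_sqrt_divide)
qed

theorem mainTheorem1:
  shows "\<exists>C>0. \<forall>(n::nat) (m::nat) (N :: real vec \<Rightarrow> real) (f :: (nat \<Rightarrow> real) \<Rightarrow> real vec).
    n \<ge> 1 \<longrightarrow> m \<ge> 1 \<longrightarrow> is_norm m N \<longrightarrow> f \<in> cube n \<rightarrow> carrier_vec m \<longrightarrow>
      sqrt (cube_expectation n (\<lambda>x. (N (linear_part n m f x))\<^sup>2))
        \<le> C * ln (real m + 1) * sqrt (cube_expectation n (\<lambda>x. (N (f x))\<^sup>2))"
proof (intro exI[of _ "16 / ln 2"] conjI allI impI)
  fix n m :: nat and N :: "real vec \<Rightarrow> real" and f :: "(nat \<Rightarrow> real) \<Rightarrow> real vec"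
  assume m: "m \<ge> 1" and N: "is_norm m N" and f: "f \<in> cube n \<rightarrow> carrier_vec m"
  \<comment> \<open>Rounding up gives \<open>m \<le> 2 ^ d\<close>, so the remainder costs no more
    than the main term and the constant is at most \<open>8 * d\<close>. As
    \<open>m \<ge> 1\<close>, the logarithm is at least 1, hence \<open>d\<close> is at most twice
    the logarithm; this gives 16, and \<open>ln 2\<close> converts the base.\<close>
  define d where "d = nat \<lceil>log 2 (real m + 1)\<rceil>"
  have log1: "log 2 (real m + 1) \<ge> 1" using m by (simp add: le_log_iff)
  then have d: "d \<ge> 1" "log 2 (real m + 1) \<le> real d" "real d \<le> log 2 (real m + 1) + 1"
    unfolding d_def by linarith+
  have "real m \<le> 2 powr log 2 (real m + 1)" by simp
  also have "\<dots> \<le> 2 powr real d" using d(2) by (intro powr_mono) auto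
  finally have "real m \<le> 2 ^ d" by (simp add: powr_realpow)
  then have "real m * (4 * real d / 2 ^ d) \<le> 2 ^ d * (4 * real d / 2 ^ d)"
    by (intro mult_right_mono) auto
  then have "4 * real d + real m * (4 * real d / 2 ^ d) \<le> 8 * real d" by simp
  also have "\<dots> \<le> 16 * log 2 (real m + 1)" using d(3) log1 by linarith
  also have "\<dots> = 16 / ln 2 * ln (real m + 1)" by (simp add: log_def)
  finally have "4 * real d + real m * (4 * real d / 2 ^ d) \<le> 16 / ln 2 * ln (real m + 1)" .
  then have "L2_set (\<lambda>x. N (linear_part n m f x)) (cube n)
     \<le> 16 / ln 2 * ln (real m + 1) * L2_set (\<lambda>x. N (f x)) (cube n)"
    by (rule order.trans[OF L2_set_linear_part_le[OF N f d(1)] mult_right_mono]) simp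
  then show "sqrt (cube_expectation n (\<lambda>x. (N (linear_part n m f x))\<^sup>2))
        \<le> 16 / ln 2 * ln (real m + 1) * sqrt (cube_expectation n (\<lambda>x. (N (f x))\<^sup>2))"
    unfolding sqrt_cube_expectation_square times_divide_eq_right
    by (rule divide_right_mono) simp
qed simp

end
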